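(* Let $H$ be a complex Hilbert space, let $R_0\in B(H)_+$, and let $(u_n)_{n\ge 0}\subset H$ be a sequence of unit vectors. Define $R_{n+1}=R_n^{1/2}(I-|u_n\rangle\langle u_n|)R_n^{1/2}$ and $E_n=R_n^{1/2}u_n$ for $n\ge 0$, and let $R_\infty$ be the strong operator limit of $(R_n)$. For every $N\ge 1$ we have $$R_0-R_N=\sum_{n=0}^{N-1}|E_n\rangle\langle E_n|.$$ Moreover, for every $x\in H$, $$\langle x,(R_0-R_\infty)x\rangle=\sum_{n=0}^\infty|\langle E_n,x\rangle|^2,$$ and the series on the right is absolutely convergent. In particular, $$R_0-R_\infty=\sum_{n=0}^\infty|E_n\rangle\langle E_n|$$ with convergence in the strong operator topology.
   Context: $B(H)_+$ is the set of bounded positive operators on $H$. Inner products are linear in the second variable. $|a\rangle\langle b|$ denotes the operator $x\mapsto\langle b,x\rangle a$. Each $R_n$ is in $B(H)_+$, and the sequence $(R_n)$ is decreasing in the Löwner order and bounded below by $0$, so it converges in the strong operator topology to some $R_\infty\in B(H)_+$ (if some $R_n=0$, then $R_k=0$ for all $k\ge n$). *)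

theory Defs
  imports "HOL-Analysis.Analysis"
begin

section \<open>Complex Hilbert spaces\<close>

class complex_vector = real_vector +
  fixes scaleC :: "complex \<Rightarrow> 'a \<Rightarrow> 'a"  (infixr "*\<^sub>C" 75)
  assumes scaleC_add_right: "c *\<^sub>C (x + y) = c *\<^sub>C x + c *\<^sub>C y"
    and scaleC_add_left: "(c + d) *\<^sub>C x = c *\<^sub>C x + d *\<^sub>C x"
    and scaleC_scaleC: "c *\<^sub>C d *\<^sub>C x = (c * d) *\<^sub>C x"
    and scaleR_scaleC: "r *\<^sub>R x = complex_of_real r *\<^sub>C x"

text \<open>The inner product is linear in the second variable and antilinear in the first.\<close>

class complex_inner = complex_vector + real_normed_vector +
  fixes cinner :: "'a \<Rightarrow> 'a \<Rightarrow> complex"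
  assumes cinner_commute: "cinner x y = cnj (cinner y x)"
    and cinner_add_right: "cinner x (y + z) = cinner x y + cinner x z"
    and cinner_scaleC_right: "cinner x (c *\<^sub>C y) = c * cinner x y"
    and cinner_ge_zero: "0 \<le> Re (cinner x x)"
    and cinner_eq_zero_iff: "cinner x x = 0 \<longleftrightarrow> x = 0"
    and norm_eq_sqrt_cinner: "norm x = sqrt (Re (cinner x x))"

class complex_hilbert_space = complex_inner + complete_space

instantiation complex :: complex_hilbert_space
begin

definition scaleC_complex :: "complex \<Rightarrow> complex \<Rightarrow> complex" where
  "scaleC_complex c z = c * z"

definition cinner_complex :: "complex \<Rightarrow> complex \<Rightarrow> complex" where
  "cinner_complex z w = cnj z * w"

instance
proof
  fix x :: complex
  show "0 \<le> Re (cinner x x)" "norm x = sqrt (Re (cinner x x))"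
    by (simp_all add: cinner_complex_def cmod_def power2_eq_square)
qed (simp_all add: scaleC_complex_def cinner_complex_def algebra_simps scaleR_conv_of_real)

end

lemma cinner_scaleC_left: "cinner (c *\<^sub>C x) y = cnj c * cinner x y"
  by (metis cinner_commute cinner_scaleC_right complex_cnj_mult)

lemma cinner_add_left: "cinner (x + y) z = cinner x z + cinner y z"
  by (metis cinner_add_right cinner_commute complex_cnj_add)

lemma cinner_self: "cinner x x = complex_of_real ((norm x)\<^sup>2)"
proof -
  have "Im (cinner x x) = 0"
    using arg_cong[OF cinner_commute[of x x], of Im] by simp
  thus ?thesis
    by (simp add: complex_eq_iff norm_eq_sqrt_cinner cinner_ge_zero)
qed

lemma norm_scaleC: "norm (c *\<^sub>C x) = cmod c * norm (x :: 'a :: complex_inner)"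
proof -
  have "complex_of_real ((norm (c *\<^sub>C x))\<^sup>2) = complex_of_real ((cmod c * norm x)\<^sup>2)"
    unfolding cinner_self[symmetric] cinner_scaleC_left cinner_scaleC_right
    by (simp add: cinner_self power_mult_distrib mult_ac flip: complex_norm_square)
  thus ?thesis
    by (simp only: of_real_eq_iff) (simp add: power2_eq_iff_nonneg)
qed

lemma cinner_Cauchy_Schwarz: "cmod (cinner x y) \<le> norm x * norm (y :: 'a :: complex_inner)"
proof (cases "x = 0")
  case True
  have "cinner (0::'a) y = 0"
    using cinner_add_left[of 0 0 y] by simp
  thus ?thesis using True by simp
next
  case False
  define a where "a = cinner x y"
  define n where "n = (norm x)\<^sup>2"
  have n: "n > 0" using False by (simp add: n_def)
  define z where "z = complex_of_real n *\<^sub>C y + (- a) *\<^sub>C x"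
  have yx: "cinner y x = cnj a" unfolding a_def by (rule cinner_commute)
  have "cinner z z = complex_of_real (n * (n * (norm y)\<^sup>2 - (cmod a)\<^sup>2))"
    unfolding z_def cinner_add_left cinner_add_right cinner_scaleC_left cinner_scaleC_right
    using complex_norm_square[of a]
    by (simp add: cinner_self yx algebra_simps flip: a_def n_def)
  hence "Re (cinner z z) = n * (n * (norm y)\<^sup>2 - (cmod a)\<^sup>2)" by simp
  with cinner_ge_zero[of z] n have "(cmod a)\<^sup>2 \<le> n * (norm y)\<^sup>2"
    by (simp add: zero_le_mult_iff)
  hence "(cmod a)\<^sup>2 \<le> (norm x * norm y)\<^sup>2"
    by (simp add: n_def power_mult_distrib)
  thus ?thesis
    unfolding a_def by (rule power2_le_imp_le) simp
qed

section \<open>Bounded operators\<close>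

text \<open>
  The type \<open>'a \<Rightarrow>\<^sub>L 'a\<close> consists of the bounded real-linear maps; \<open>B(H)\<close> is its subset of
  complex-linear ones.
\<close>

definition bounded_ops :: "('a :: complex_inner \<Rightarrow>\<^sub>L 'a) set" where
  "bounded_ops = {T. \<forall>c x. blinfun_apply T (c *\<^sub>C x) = c *\<^sub>C blinfun_apply T x}"

definition positive_ops :: "('a :: complex_inner \<Rightarrow>\<^sub>L 'a) set" where
  "positive_ops = {T \<in> bounded_ops. \<forall>x. cinner x (blinfun_apply T x) \<in> \<real> \<and> 0 \<le> Re (cinner x (blinfun_apply T x))}"

text \<open>Meaningful for \<open>T \<in> positive_ops\<close>, which has exactly one positive square root.\<close>

definition sqrt_op :: "('a :: complex_inner \<Rightarrow>\<^sub>L 'a) \<Rightarrow> ('a \<Rightarrow>\<^sub>L 'a)" where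
  "sqrt_op T = (THE S. S \<in> positive_ops \<and> S o\<^sub>L S = T)"

lift_definition ketbra :: "'a :: complex_inner \<Rightarrow> 'a \<Rightarrow> ('a \<Rightarrow>\<^sub>L 'a)" is
  "\<lambda>a b x. cinner b x *\<^sub>C a"
proof -
  fix a b :: 'a
  show "bounded_linear (\<lambda>x. cinner b x *\<^sub>C a)"
  proof (rule bounded_linear_intro[where K = "norm b * norm a"])
    fix x y :: 'a and r :: real
    show "cinner b (x + y) *\<^sub>C a = cinner b x *\<^sub>C a + cinner b y *\<^sub>C a"
      by (simp add: cinner_add_right scaleC_add_left)
    show "cinner b (r *\<^sub>R x) *\<^sub>C a = r *\<^sub>R (cinner b x *\<^sub>C a)"
      by (simp add: scaleR_scaleC cinner_scaleC_right scaleC_scaleC)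
    show "norm (cinner b x *\<^sub>C a) \<le> norm x * (norm b * norm a)"
      using mult_right_mono[OF cinner_Cauchy_Schwarz[of b x], of "norm a"]
      by (simp add: norm_scaleC mult_ac)
  qed
qed

text \<open>The strong operator topology is Hausdorff, so a sequence has at most one limit.\<close>

definition sot_lim :: "(nat \<Rightarrow> ('a :: complex_inner \<Rightarrow>\<^sub>L 'a)) \<Rightarrow> ('a \<Rightarrow>\<^sub>L 'a)" where
  "sot_lim T = (THE L. limitin strong_operator_topology T L sequentially)"

end

theory Submission
  imports Defs
begin

text \<open>
  Writing \<open>S\<close> for the positive square root of \<open>R n\<close>, the recursion gives
  \<open>R n - R (Suc n) = S |u n\<rangle>\<langle>u n| S\<close>, and since \<open>S\<close> is Hermitian this is the rank-one operator
  \<open>|E n\<rangle>\<langle>E n|\<close> (\<open>sqrt_sandwich_diff\<close>). The finite identity is therefore a telescoping sum, and the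
  partial sums of \<open>|E n\<rangle>\<langle>E n|\<close> are exactly \<open>R 0 - R N\<close>. Because \<open>u n\<close> is a unit vector,
  \<open>I - |u n\<rangle>\<langle>u n|\<close> is positive, so \<open>R\<close> stays positive (\<open>sqrt_sandwich_positive\<close>), and it decreases.
  A decreasing sequence of positive operators converges strongly
  (\<open>decreasing_positive_sot_convergent\<close>), which yields the strong sum; pairing with \<open>x\<close> turns it
  into the scalar series, whose terms are nonnegative.

  Two facts of operator theory carry this argument. The first is that a positive operator has
  exactly one positive square root, without which \<open>sqrt_op\<close> says nothing. For \<open>0 \<le> A \<le> I\<close> the root
  is \<open>I - Y\<close>, where \<open>Y\<close> solves \<open>Y = (B + Y\<^sup>2) / 2\<close> with \<open>B = I - A\<close>; the iterates of this equation
  from \<open>0\<close> converge in norm, because their increments are dominated by those of the scalar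
  iteration with \<open>B\<close> replaced by \<open>1\<close>. The root commutes with everything that commutes with \<open>A\<close>,
  and this gives uniqueness. The second is the inequality \<open>\<parallel>T x\<parallel>\<^sup>2 \<le> \<parallel>T\<parallel> \<langle>x, T x\<rangle>\<close> for positive
  \<open>T\<close> (\<open>positive_norm_apply\<close>), which turns information about quadratic forms into information about
  vectors; the norm estimates, the uniqueness of roots and the strong convergence all rest on it.
\<close>

section \<open>The inner product\<close>

instance complex_hilbert_space \<subseteq> banach ..

lemma bounded_bilinear_cinner: "bounded_bilinear (cinner :: 'a :: complex_inner \<Rightarrow> 'a \<Rightarrow> complex)"
proof
  show "\<exists>K. \<forall>x y :: 'a. norm (cinner x y) \<le> norm x * norm y * K"
    by (rule exI[of _ 1]) (simp add: cinner_Cauchy_Schwarz)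
  show "cinner (r *\<^sub>R x) y = r *\<^sub>R cinner x y" "cinner x (r *\<^sub>R y) = r *\<^sub>R cinner x y" for r and x y :: 'a
    by (simp_all only: scaleR_scaleC cinner_scaleC_left cinner_scaleC_right scaleC_complex_def complex_cnj_complex_of_real)
qed (rule cinner_add_left cinner_add_right)+

interpretation cinner: bounded_bilinear "cinner :: 'a :: complex_inner \<Rightarrow> 'a \<Rightarrow> complex"
  by (rule bounded_bilinear_cinner)

lemma Re_cinner_self: "Re (cinner x x) = (norm x)\<^sup>2"
  by (simp add: cinner_self)

lemma Re_cinner_le: "Re (cinner x y) \<le> norm x * norm y"
  using complex_Re_le_cmod[of "cinner x y"] cinner_Cauchy_Schwarz[of x y] by linarith

lemma cinner_ext:
  assumes "\<And>x. cinner x y = cinner x z"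
  shows "y = z"
proof -
  have "cinner (y - z) (y - z) = 0"
    using assms[of "y - z"] by (simp add: cinner.diff_right)
  thus ?thesis by (simp add: cinner_eq_zero_iff)
qed

section \<open>Hermitian and positive operators\<close>

text \<open>
  Symmetry for the complex inner product forces complex linearity of a real-linear map, and it
  passes to pointwise limits, which makes it the convenient half of positivity.
\<close>

definition hermitian :: "('a :: complex_inner \<Rightarrow>\<^sub>L 'a) \<Rightarrow> bool" where
  "hermitian T \<longleftrightarrow> (\<forall>x y. cinner x (T y) = cinner (T x) y)"

lemma hermitianD: "hermitian T \<Longrightarrow> cinner (T x) y = cinner x (T y)"
  by (simp add: hermitian_def)

lemma hermitian_Im: "hermitian T \<Longrightarrow> Im (cinner x (T x)) = 0"
  using arg_cong[OF cinner_commute[of x "T x"], of Im] by (simp add: hermitian_def)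

lemma hermitian_complex_linear:
  assumes "hermitian T"
  shows "T \<in> bounded_ops"
  unfolding bounded_ops_def
proof (intro CollectI allI)
  fix c x
  show "T (c *\<^sub>C x) = c *\<^sub>C T x"
    by (rule cinner_ext)
      (simp add: cinner_scaleC_right hermitianD[OF assms, symmetric])
qed

text \<open>
  Polarization: the form \<open>cinner x (T x)\<close> is real at \<open>x + y\<close>, which makes
  \<open>cinner x (T y) + cinner y (T x)\<close> real, and at \<open>x + \<i> *\<^sub>C y\<close>, which makes
  \<open>cinner x (T y) - cinner y (T x)\<close> purely imaginary.
\<close>

lemma positive_hermitian:
  assumes "T \<in> positive_ops"
  shows "hermitian T"
  unfolding hermitian_def
proof (intro allI)
  fix x y
  have lin: "T (c *\<^sub>C x) = c *\<^sub>C T x" and im: "Im (cinner x (T x)) = 0" for c x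
    using assms by (auto simp: positive_ops_def bounded_ops_def complex_is_Real_iff)
  have "Im (cinner x (T y)) + Im (cinner y (T x)) = 0"
    using im[of "x + y"] im[of x] im[of y]
    by (simp add: cinner_add_left cinner_add_right blinfun.add_right)
  moreover have "Re (cinner x (T y)) - Re (cinner y (T x)) = 0"
    using im[of "x + \<i> *\<^sub>C y"] im[of x] im[of y]
    by (simp add: cinner_add_left cinner_add_right blinfun.add_right lin
        cinner_scaleC_left cinner_scaleC_right)
  ultimately have "cinner x (T y) = cnj (cinner y (T x))"
    by (simp add: complex_eq_iff)
  thus "cinner x (T y) = cinner (T x) y"
    by (simp flip: cinner_commute)
qed

lemma positive_ops_iff:
  "T \<in> positive_ops \<longleftrightarrow> hermitian T \<and> (\<forall>x. 0 \<le> Re (cinner x (T x)))"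
proof
  assume "T \<in> positive_ops"
  thus "hermitian T \<and> (\<forall>x. 0 \<le> Re (cinner x (T x)))"
    using positive_hermitian by (auto simp: positive_ops_def)
next
  assume "hermitian T \<and> (\<forall>x. 0 \<le> Re (cinner x (T x)))"
  thus "T \<in> positive_ops"
    by (simp add: positive_ops_def hermitian_complex_linear hermitian_Im complex_is_Real_iff)
qed

lemma positiveD: "T \<in> positive_ops \<Longrightarrow> 0 \<le> Re (cinner x (T x))"
  by (simp add: positive_ops_def)

lemma hermitian_diff: "hermitian S \<Longrightarrow> hermitian T \<Longrightarrow> hermitian (S - T)"
  by (simp add: hermitian_def blinfun.diff_left cinner.diff_left cinner.diff_right)

lemma hermitian_scaleR: "hermitian T \<Longrightarrow> hermitian (r *\<^sub>R T)"
  by (simp add: hermitian_def blinfun.scaleR_left cinner.scaleR_left cinner.scaleR_right)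

lemma hermitian_id: "hermitian id_blinfun"
  by (simp add: hermitian_def)

lemma hermitian_limit:
  fixes T :: "'a :: complex_inner \<Rightarrow>\<^sub>L 'a"
  assumes "\<And>n. hermitian (X n)" and "\<And>x. (\<lambda>n. X n x) \<longlonglongrightarrow> T x"
  shows "hermitian T"
  unfolding hermitian_def
proof (intro allI)
  fix x y
  have "(\<lambda>n. cinner x (X n y)) \<longlonglongrightarrow> cinner x (T y)"
    by (intro cinner.tendsto tendsto_const assms(2))
  moreover have "(\<lambda>n. cinner x (X n y)) \<longlonglongrightarrow> cinner (T x) y"
    unfolding hermitianD[OF assms(1), symmetric]
    by (intro cinner.tendsto tendsto_const assms(2))
  ultimately show "cinner x (T y) = cinner (T x) y"
    by (rule LIMSEQ_unique)
qed

text \<open>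
  This is the Cauchy-Schwarz inequality for the form of \<open>T\<close>, specialised to the vectors \<open>x\<close> and
  \<open>T x\<close>. It follows from the positivity of the form at the single point \<open>x - t *\<^sub>R T x\<close> with
  \<open>t = 1 / norm T\<close>.
\<close>

lemma positive_norm_apply:
  assumes T: "T \<in> positive_ops"
  shows "(norm (T x))\<^sup>2 \<le> norm T * Re (cinner x (T x))"
proof (cases "norm T = 0")
  case True
  thus ?thesis by simp
next
  case False
  define t where "t = 1 / norm T"
  have h: "hermitian T" by (rule positive_hermitian[OF T])
  have h2: "cinner x (T (T x)) = cinner (T x) (T x)"
    by (rule hermitianD[OF h, symmetric])
  define b where "b = Re (cinner (T x) (T (T x)))"
  have "0 \<le> Re (cinner (x - t *\<^sub>R T x) (T (x - t *\<^sub>R T x)))"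
    by (rule positiveD[OF T])
  also have "\<dots> = Re (cinner x (T x)) - 2 * t * (norm (T x))\<^sup>2 + t\<^sup>2 * b"
    by (simp add: b_def blinfun.diff_right blinfun.scaleR_right cinner.diff_left cinner.diff_right
        cinner.scaleR_left cinner.scaleR_right h2 Re_cinner_self
        algebra_simps power2_eq_square)
  also have "b \<le> norm (T x) * (norm T * norm (T x))"
    unfolding b_def
    by (rule order_trans[OF Re_cinner_le mult_left_mono[OF norm_blinfun]]) simp
  hence "t\<^sup>2 * b \<le> t\<^sup>2 * (norm (T x) * (norm T * norm (T x)))"
    by (rule mult_left_mono) simp
  also have "\<dots> = t * (norm (T x))\<^sup>2"
    using False by (simp add: t_def power2_eq_square)
  finally have "t * (norm (T x))\<^sup>2 \<le> Re (cinner x (T x))"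
    by simp
  thus ?thesis
    using False by (simp add: t_def field_simps)
qed

text \<open>
  Bounding the form of \<open>S\<close> by that of \<open>T\<close> in the previous inequality only gives
  \<open>norm (S x)^2 \<le> norm S * norm T * norm x^2\<close>, hence \<open>norm S ^ 2 \<le> norm S * norm T\<close>, where one
  factor cancels.
\<close>

lemma positive_norm_mono:
  assumes S: "S \<in> positive_ops" and ST: "T - S \<in> positive_ops"
  shows "norm S \<le> norm T"
proof -
  have "norm S \<le> sqrt (norm S * norm T)"
  proof (rule norm_blinfun_bound)
    fix x
    have "Re (cinner x (S x)) \<le> Re (cinner x (T x))"
      using positiveD[OF ST, of x] by (simp add: blinfun.diff_left cinner.diff_right)
    also have "\<dots> \<le> norm x * (norm T * norm x)"
      by (rule order_trans[OF Re_cinner_le mult_left_mono[OF norm_blinfun]]) simp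
    finally have "norm S * Re (cinner x (S x)) \<le> norm S * (norm x * (norm T * norm x))"
      by (rule mult_left_mono) simp
    with positive_norm_apply[OF S, of x]
    have "(norm (S x))\<^sup>2 \<le> (sqrt (norm S * norm T) * norm x)\<^sup>2"
      by (simp add: power_mult_distrib power2_eq_square mult_ac)
    thus "norm (S x) \<le> sqrt (norm S * norm T) * norm x"
      by (rule power2_le_imp_le) simp
  qed simp
  hence "(norm S)\<^sup>2 \<le> norm S * norm T"
    using power_mono[of "norm S" "sqrt (norm S * norm T)" 2] by simp
  thus ?thesis
    by (cases "norm S = 0") (auto simp: power2_eq_square)
qed

section \<open>Square roots\<close>

lemma blinfun_compose_eqD: "S o\<^sub>L T = U o\<^sub>L V \<Longrightarrow> S (T x) = U (V x)"
  by (metis blinfun_apply_blinfun_compose)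

text \<open>
  A fixed point \<open>Y\<close> of \<open>Y \<mapsto> (B + Y\<^sup>2) / 2\<close> satisfies \<open>(I - Y)\<^sup>2 = I - B\<close>.
\<close>

primrec sqrt_iter :: "('a :: real_normed_vector \<Rightarrow>\<^sub>L 'a) \<Rightarrow> nat \<Rightarrow> ('a \<Rightarrow>\<^sub>L 'a)" where
  "sqrt_iter B 0 = 0"
| "sqrt_iter B (Suc n) = (1/2) *\<^sub>R (B + (sqrt_iter B n o\<^sub>L sqrt_iter B n))"

text \<open>The same iteration for the number \<open>1\<close>, the largest value of \<open>norm B\<close> to be considered.\<close>

primrec scalar_iter :: "nat \<Rightarrow> real" where
  "scalar_iter 0 = 0"
| "scalar_iter (Suc n) = (1 + (scalar_iter n)\<^sup>2) / 2"

lemma scalar_iter_bounds: "0 \<le> scalar_iter n \<and> scalar_iter n \<le> 1"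
  by (induction n) (auto simp: power_le_one)

lemma incseq_scalar_iter: "incseq scalar_iter"
proof (rule incseq_SucI)
  fix n
  show "scalar_iter n \<le> scalar_iter (Suc n)"
    using zero_le_power2[of "1 - scalar_iter n"] by (simp add: power2_eq_square algebra_simps)
qed

lemma norm_sqrt_iter_le:
  assumes "norm B \<le> 1"
  shows "norm (sqrt_iter B n) \<le> scalar_iter n"
proof (induction n)
  case (Suc n)
  have "norm (sqrt_iter B n o\<^sub>L sqrt_iter B n) \<le> (scalar_iter n)\<^sup>2"
    using order_trans[OF norm_blinfun_compose mult_mono[OF Suc.IH Suc.IH]] scalar_iter_bounds[of n]
    by (simp add: power2_eq_square)
  thus ?case
    using norm_triangle_ineq[of B "sqrt_iter B n o\<^sub>L sqrt_iter B n"] assms by simp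
qed simp

text \<open>
  With \<open>X\<close>, \<open>Y\<close> two consecutive iterates, the next increment is half of
  \<open>Y\<^sup>2 - X\<^sup>2 = Y (Y - X) + (Y - X) X\<close>. This splitting holds in any ring, commutative or not, and its
  scalar counterpart is the factorization of a difference of squares, so the two iterations can
  be compared term by term.
\<close>

lemma norm_sqrt_iter_step:
  assumes B: "norm B \<le> 1"
  shows "norm (sqrt_iter B (Suc n) - sqrt_iter B n) \<le> scalar_iter (Suc n) - scalar_iter n"
proof (induction n)
  case 0
  thus ?case using B by simp
next
  case (Suc n)
  define X Y where "X = sqrt_iter B n" and "Y = sqrt_iter B (Suc n)"
  define a b where "a = scalar_iter n" and "b = scalar_iter (Suc n)"
  have XY: "norm (Y - X) \<le> b - a" "norm X \<le> a" "norm Y \<le> b"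
    using Suc.IH norm_sqrt_iter_le[OF B] unfolding X_def Y_def a_def b_def by blast+
  have ab: "0 \<le> a" "a \<le> b"
    using scalar_iter_bounds incseqD[OF incseq_scalar_iter, of n "Suc n"]
    unfolding a_def b_def by auto
  have "sqrt_iter B (Suc (Suc n)) - Y = (1/2) *\<^sub>R ((Y o\<^sub>L (Y - X)) + ((Y - X) o\<^sub>L X))"
  proof -
    have "sqrt_iter B (Suc (Suc n)) = (1/2) *\<^sub>R (B + (Y o\<^sub>L Y))"
      unfolding Y_def by (rule sqrt_iter.simps(2))
    moreover have "Y = (1/2) *\<^sub>R (B + (X o\<^sub>L X))"
      unfolding Y_def X_def by (rule sqrt_iter.simps(2))
    ultimately have "sqrt_iter B (Suc (Suc n)) - Y = (1/2) *\<^sub>R (B + (Y o\<^sub>L Y)) - (1/2) *\<^sub>R (B + (X o\<^sub>L X))"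
      by simp
    also have "\<dots> = (1/2) *\<^sub>R ((Y o\<^sub>L (Y - X)) + ((Y - X) o\<^sub>L X))"
      by (rule blinfun_eqI) (simp add: blinfun.bilinear_simps algebra_simps)
    finally show ?thesis .
  qed
  moreover have "norm ((Y o\<^sub>L (Y - X)) + ((Y - X) o\<^sub>L X)) \<le> b * (b - a) + (b - a) * a"
  proof (rule norm_triangle_mono)
    show "norm (Y o\<^sub>L (Y - X)) \<le> b * (b - a)"
      using XY ab by (intro order_trans[OF norm_blinfun_compose mult_mono]) auto
    show "norm ((Y - X) o\<^sub>L X) \<le> (b - a) * a"
      using XY ab by (intro order_trans[OF norm_blinfun_compose mult_mono]) auto
  qed
  moreover have "scalar_iter (Suc (Suc n)) - b = (b * (b - a) + (b - a) * a) / 2"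
  proof -
    have "scalar_iter (Suc (Suc n)) = (1 + b\<^sup>2) / 2"
      unfolding b_def by (rule scalar_iter.simps(2))
    moreover have "2 * b = 1 + a\<^sup>2"
      unfolding a_def b_def by simp
    ultimately show ?thesis by (simp add: power2_eq_square algebra_simps)
  qed
  ultimately show ?case
    unfolding Y_def[symmetric] b_def[symmetric] by simp
qed

lemma norm_sqrt_iter_diff:
  assumes "norm B \<le> 1" and "m \<le> n"
  shows "norm (sqrt_iter B n - sqrt_iter B m) \<le> scalar_iter n - scalar_iter m"
  using assms(2)
proof (induction n rule: dec_induct)
  case (step n)
  have "norm ((sqrt_iter B (Suc n) - sqrt_iter B n) + (sqrt_iter B n - sqrt_iter B m))
    \<le> (scalar_iter (Suc n) - scalar_iter n) + (scalar_iter n - scalar_iter m)"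
    by (rule norm_triangle_mono[OF norm_sqrt_iter_step[OF assms(1)] step.IH])
  thus ?case by simp
qed simp

text \<open>The scalar iteration is increasing and bounded, hence Cauchy, and it dominates.\<close>

lemma convergent_sqrt_iter:
  fixes B :: "'a :: complex_hilbert_space \<Rightarrow>\<^sub>L 'a"
  assumes B: "norm B \<le> 1"
  shows "convergent (sqrt_iter B)"
proof -
  have "convergent scalar_iter"
    using incseq_convergent[OF incseq_scalar_iter, of 1] scalar_iter_bounds
    unfolding convergent_def by metis
  hence c: "Cauchy scalar_iter" by (rule convergent_Cauchy)
  have "Cauchy (sqrt_iter B)"
  proof (rule CauchyI')
    fix e :: real assume "0 < e"
    from metric_CauchyD[OF c this] obtain M
      where M: "\<And>m n. m \<ge> M \<Longrightarrow> n \<ge> M \<Longrightarrow> dist (scalar_iter m) (scalar_iter n) < e" by blast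
    have "norm (sqrt_iter B m - sqrt_iter B n) < e" if "m \<ge> M" "m < n" for m n
      using norm_sqrt_iter_diff[OF B, of m n] M[of m n] that
      by (simp add: norm_minus_commute dist_real_def)
    thus "\<exists>M. \<forall>m\<ge>M. \<forall>n>m. dist (sqrt_iter B m) (sqrt_iter B n) < e"
      unfolding dist_norm by blast
  qed
  thus ?thesis by (rule Cauchy_convergent)
qed

lemma hermitian_sqrt_iter:
  assumes "hermitian B"
  shows "hermitian (sqrt_iter B n)"
proof (induction n)
  case 0
  show ?case by (simp add: hermitian_def cinner.zero_left cinner.zero_right)
next
  case (Suc n)
  thus ?case
    using assms by (simp add: hermitian_def blinfun.bilinear_simps cinner.add_left cinner.add_right
        cinner.scaleR_left cinner.scaleR_right)
qed

lemma sqrt_iter_commute: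
  assumes "C o\<^sub>L B = B o\<^sub>L C"
  shows "C o\<^sub>L sqrt_iter B n = sqrt_iter B n o\<^sub>L C"
proof (induction n)
  case (Suc n)
  have "C (B x) = B (C x)" "C (sqrt_iter B n x) = sqrt_iter B n (C x)" for x
    by (rule blinfun_compose_eqD[OF assms], rule blinfun_compose_eqD[OF Suc.IH])
  thus ?case
    by (intro blinfun_eqI) (simp add: blinfun.bilinear_simps)
qed simp

text \<open>
  The statement about \<open>C\<close> is what uniqueness will need. It holds because the root is a norm limit
  of polynomials in \<open>A\<close>.
\<close>

lemma positive_sqrt_contraction:
  fixes A :: "'a :: complex_hilbert_space \<Rightarrow>\<^sub>L 'a"
  assumes A: "A \<in> positive_ops" and A1: "norm A \<le> 1"
  shows "\<exists>S. S \<in> positive_ops \<and> S o\<^sub>L S = A \<and> (\<forall>C. C o\<^sub>L A = A o\<^sub>L C \<longrightarrow> C o\<^sub>L S = S o\<^sub>L C)"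
proof -
  define B where "B = id_blinfun - A"
  have hB: "hermitian B"
    unfolding B_def by (intro hermitian_diff hermitian_id positive_hermitian A)
  \<comment> \<open>Expanding the square, \<open>norm (B x)^2 \<le> norm x ^ 2\<close> amounts to
    \<open>norm (A x)^2 \<le> 2 * Re (cinner x (A x))\<close>.\<close>
  have B1: "norm B \<le> 1"
  proof (rule norm_blinfun_bound)
    fix x
    have "(norm (B x))\<^sup>2 = (norm x)\<^sup>2 - 2 * Re (cinner x (A x)) + (norm (A x))\<^sup>2"
      unfolding Re_cinner_self[symmetric] B_def
      by (simp add: blinfun.bilinear_simps cinner.diff_left cinner.diff_right
          hermitianD[OF positive_hermitian[OF A]])
    also have "(norm (A x))\<^sup>2 \<le> 1 * Re (cinner x (A x))"
      by (rule order_trans[OF positive_norm_apply[OF A] mult_right_mono[OF A1 positiveD[OF A]]])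
    finally have "(norm (B x))\<^sup>2 \<le> (norm x)\<^sup>2"
      using positiveD[OF A, of x] by linarith
    thus "norm (B x) \<le> 1 * norm x"
      using power2_le_imp_le[of "norm (B x)" "norm x"] by simp
  qed simp
  from convergent_sqrt_iter[OF B1] obtain Y where Y: "sqrt_iter B \<longlonglongrightarrow> Y"
    by (auto simp: convergent_def)
  have Yx: "(\<lambda>n. sqrt_iter B n x) \<longlonglongrightarrow> Y x" for x
    by (intro tendsto_intros Y)
  have "(\<lambda>n. sqrt_iter B (Suc n)) \<longlonglongrightarrow> (1/2) *\<^sub>R (B + (Y o\<^sub>L Y))"
    unfolding sqrt_iter.simps
    by (intro tendsto_intros bounded_bilinear.tendsto[OF bounded_bilinear_blinfun_compose] Y)
  hence "Y = (1/2) *\<^sub>R (B + (Y o\<^sub>L Y))"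
    using LIMSEQ_unique[OF LIMSEQ_Suc[OF Y]] by blast
  hence "2 *\<^sub>R Y = 2 *\<^sub>R ((1/2) *\<^sub>R (B + (Y o\<^sub>L Y)))"
    by (rule arg_cong)
  hence fix_Y: "2 *\<^sub>R Y = B + (Y o\<^sub>L Y)"
    by simp
  have nY: "norm Y \<le> 1"
    using norm_sqrt_iter_le[OF B1] scalar_iter_bounds
    by (intro LIMSEQ_le_const2[OF tendsto_norm[OF Y]]) (meson order_trans)
  define S where "S = id_blinfun - Y"
  have "S \<in> positive_ops"
    unfolding positive_ops_iff
  proof (intro conjI allI)
    show "hermitian S"
      unfolding S_def by (intro hermitian_diff hermitian_id hermitian_limit[OF hermitian_sqrt_iter[OF hB] Yx])
    fix x
    have "Re (cinner x (Y x)) \<le> norm x * (1 * norm x)"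
      using nY by (intro order_trans[OF Re_cinner_le] mult_left_mono order_trans[OF norm_blinfun] mult_right_mono) auto
    thus "0 \<le> Re (cinner x (S x))"
      by (simp add: S_def blinfun.bilinear_simps cinner.diff_right Re_cinner_self power2_eq_square)
  qed
  moreover have "S o\<^sub>L S = A"
  proof (rule blinfun_eqI)
    fix x
    have "Y x + Y x = B x + Y (Y x)"
      using arg_cong[OF fix_Y, of "\<lambda>T. T x"] by (simp add: blinfun.bilinear_simps scaleR_2)
    thus "(S o\<^sub>L S) x = A x"
      by (simp add: S_def B_def blinfun.bilinear_simps algebra_simps)
  qed
  moreover have "C o\<^sub>L S = S o\<^sub>L C" if "C o\<^sub>L A = A o\<^sub>L C" for C
  proof -
    have "C (A x) = A (C x)" for x
      by (rule blinfun_compose_eqD[OF that])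
    hence "C o\<^sub>L B = B o\<^sub>L C"
      by (intro blinfun_eqI) (simp add: B_def blinfun.bilinear_simps)
    note comm = sqrt_iter_commute[OF this]
    have "(\<lambda>n. C o\<^sub>L sqrt_iter B n) \<longlonglongrightarrow> (C o\<^sub>L Y)"
      by (intro bounded_bilinear.tendsto[OF bounded_bilinear_blinfun_compose] Y tendsto_const)
    moreover have "(\<lambda>n. C o\<^sub>L sqrt_iter B n) \<longlonglongrightarrow> (Y o\<^sub>L C)"
      unfolding comm
      by (intro bounded_bilinear.tendsto[OF bounded_bilinear_blinfun_compose] Y tendsto_const)
    ultimately have "C o\<^sub>L Y = Y o\<^sub>L C" by (rule LIMSEQ_unique)
    hence "C (Y x) = Y (C x)" for x
      by (rule blinfun_compose_eqD)
    thus ?thesis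
      by (intro blinfun_eqI) (simp add: S_def blinfun.bilinear_simps)
  qed
  ultimately show ?thesis by blast
qed

lemma positive_sqrt_exists:
  fixes A :: "'a :: complex_hilbert_space \<Rightarrow>\<^sub>L 'a"
  assumes A: "A \<in> positive_ops"
  obtains S where "S \<in> positive_ops" "S o\<^sub>L S = A" "\<And>C. C o\<^sub>L A = A o\<^sub>L C \<Longrightarrow> C o\<^sub>L S = S o\<^sub>L C"
proof -
  \<comment> \<open>Any \<open>r \<ge> norm A\<close> makes \<open>A / r\<close> a contraction; the added \<open>1\<close> keeps \<open>r\<close> nonzero for \<open>A = 0\<close>.\<close>
  define r where "r = norm A + 1"
  have r: "r > 0" by (simp add: r_def add_nonneg_pos)
  have scale: "c *\<^sub>R T \<in> positive_ops" if "T \<in> positive_ops" "c \<ge> 0" for c and T :: "'a \<Rightarrow>\<^sub>L 'a"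
    using that by (simp add: positive_ops_iff hermitian_scaleR blinfun.scaleR_left cinner.scaleR_right)
  have "(1/r) *\<^sub>R A \<in> positive_ops" "norm ((1/r) *\<^sub>R A) \<le> 1"
    using r by (auto intro!: scale A) (simp add: r_def)
  from positive_sqrt_contraction[OF this] obtain S where S: "S \<in> positive_ops"
    "S o\<^sub>L S = (1/r) *\<^sub>R A"
    and comm: "\<And>C. C o\<^sub>L ((1/r) *\<^sub>R A) = ((1/r) *\<^sub>R A) o\<^sub>L C \<Longrightarrow> C o\<^sub>L S = S o\<^sub>L C" by blast
  note compose = bounded_bilinear.scaleR_left[OF bounded_bilinear_blinfun_compose]
    bounded_bilinear.scaleR_right[OF bounded_bilinear_blinfun_compose]
  show thesis
  proof
    show "sqrt r *\<^sub>R S \<in> positive_ops" by (rule scale[OF S(1)]) (use r in simp)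
    show "(sqrt r *\<^sub>R S) o\<^sub>L (sqrt r *\<^sub>R S) = A" using r by (simp add: compose S(2))
    show "C o\<^sub>L (sqrt r *\<^sub>R S) = (sqrt r *\<^sub>R S) o\<^sub>L C" if "C o\<^sub>L A = A o\<^sub>L C" for C
      using comm[of C] that by (simp add: compose)
  qed
qed

text \<open>
  For commuting roots \<open>(S + T) (S - T) = S\<^sup>2 - T\<^sup>2 = 0\<close>. With \<open>y = (S - T) x\<close>, the forms of \<open>S\<close> and \<open>T\<close>
  at \<open>y\<close> are nonnegative with sum zero, so both vanish and \<open>S y = T y = 0\<close>. Then
  \<open>cinner y y = cinner x ((S - T) y) = 0\<close>.
\<close>

lemma positive_sqrt_unique_commuting:
  assumes S: "S \<in> positive_ops" and T: "T \<in> positive_ops"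
    and comm: "S o\<^sub>L T = T o\<^sub>L S" and eq: "S o\<^sub>L S = T o\<^sub>L T"
  shows "S = T"
proof (rule blinfun_eqI)
  fix x
  define y where "y = S x - T x"
  have c: "S (T z) = T (S z)" "S (S z) = T (T z)" for z
    by (rule blinfun_compose_eqD[OF comm], rule blinfun_compose_eqD[OF eq])
  have "S y + T y = 0"
    by (simp add: y_def blinfun.diff_right c)
  hence "Re (cinner y (S y)) + Re (cinner y (T y)) = 0"
    by (metis cinner.add_right cinner.zero_right plus_complex.sel(1) zero_complex.sel(1))
  hence "Re (cinner y (S y)) = 0" "Re (cinner y (T y)) = 0"
    using positiveD[OF S, of y] positiveD[OF T, of y] by linarith+
  hence "S y = 0" "T y = 0"
    using positive_norm_apply[OF S, of y] positive_norm_apply[OF T, of y] by simp_all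
  moreover have "cinner y y = cinner x (S y - T y)"
    by (subst (1) y_def)
      (simp add: cinner.diff_left cinner.diff_right hermitianD positive_hermitian S T)
  ultimately have "cinner y y = 0"
    by (simp add: cinner.zero_right)
  hence "y = 0"
    by (simp only: cinner_eq_zero_iff)
  thus "S x = T x" by (simp add: y_def)
qed

text \<open>
  An arbitrary positive root \<open>T\<close> of \<open>A\<close> commutes with \<open>A = T\<^sup>2\<close>, hence with the root \<open>S\<close> constructed
  above, and so it equals \<open>S\<close>. Thus the definite description in \<open>sqrt_op\<close> denotes.
\<close>

lemma sqrt_op:
  fixes A :: "'a :: complex_hilbert_space \<Rightarrow>\<^sub>L 'a"
  assumes A: "A \<in> positive_ops"
  shows sqrt_op_positive: "sqrt_op A \<in> positive_ops"
    and sqrt_op_square: "sqrt_op A o\<^sub>L sqrt_op A = A"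
proof -
  obtain S where S: "S \<in> positive_ops" "S o\<^sub>L S = A"
    and comm: "\<And>C. C o\<^sub>L A = A o\<^sub>L C \<Longrightarrow> C o\<^sub>L S = S o\<^sub>L C"
    using positive_sqrt_exists[OF A] by blast
  have uniq: "T = S" if T: "T \<in> positive_ops" "T o\<^sub>L T = A" for T
  proof (rule positive_sqrt_unique_commuting[OF T(1) S(1)])
    show "T o\<^sub>L S = S o\<^sub>L T"
      by (rule comm) (rule blinfun_eqI, simp flip: T(2))
    show "T o\<^sub>L T = S o\<^sub>L S" by (simp add: S T)
  qed
  have "sqrt_op A = S"
    unfolding sqrt_op_def by (rule the_equality) (use S uniq in blast)+
  thus "sqrt_op A \<in> positive_ops" "sqrt_op A o\<^sub>L sqrt_op A = A"
    using S by simp_all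
qed

section \<open>Monotone convergence in the strong operator topology\<close>

text \<open>
  The strong operator topology is pulled back from the topology on functions, which is the
  product topology; convergence there is coordinatewise.
\<close>

lemma limitin_strong_operator_iff:
  fixes X :: "nat \<Rightarrow> 'a :: real_normed_vector \<Rightarrow>\<^sub>L 'b :: real_normed_vector"
  shows "limitin strong_operator_topology X T sequentially \<longleftrightarrow> (\<forall>x. (\<lambda>n. X n x) \<longlonglongrightarrow> T x)"
proof
  assume lim: "limitin strong_operator_topology X T sequentially"
  show "\<forall>x. (\<lambda>n. X n x) \<longlonglongrightarrow> T x"
    using continuous_map_limit[OF strong_operator_topology_continuous_evaluation lim]
    by (simp add: comp_def)
next
  assume "\<forall>x. (\<lambda>n. X n x) \<longlonglongrightarrow> T x"
  hence lim: "limitin euclidean (\<lambda>n. blinfun_apply (X n)) (blinfun_apply T) sequentially"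
    by (simp add: limitin_componentwise flip: euclidean_product_topology)
  show "limitin strong_operator_topology X T sequentially"
    unfolding limitin_def strong_operator_topology_topspace
  proof (intro conjI UNIV_I allI impI, elim conjE)
    fix U assume "openin strong_operator_topology U" "T \<in> U"
    then obtain V where "openin euclidean V" and U: "U = blinfun_apply -` V \<inter> UNIV"
      unfolding strong_operator_topology_def openin_pullback_topology by blast
    with lim \<open>T \<in> U\<close> show "\<forall>\<^sub>F n in sequentially. X n \<in> U"
      unfolding limitin_def by auto
  qed
qed

lemma sot_lim_eqI:
  fixes X :: "nat \<Rightarrow> 'a :: complex_inner \<Rightarrow>\<^sub>L 'a"
  assumes "limitin strong_operator_topology X T sequentially"
  shows "sot_lim X = T"
  unfolding sot_lim_def
proof (rule the_equality[where P = "\<lambda>L. limitin strong_operator_topology X L sequentially", OF assms])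
  fix L assume "limitin strong_operator_topology X L sequentially"
  thus "L = T"
    using assms unfolding limitin_strong_operator_iff by (intro blinfun_eqI) (blast intro: LIMSEQ_unique)
qed

text \<open>
  For each \<open>x\<close> the forms \<open>cinner x (R n x)\<close> decrease and are bounded below, hence are Cauchy. The
  differences \<open>R m - R n\<close> are positive with norms bounded by \<open>norm (R 0)\<close>, so the inequality
  between \<open>norm (T x)^2\<close> and the form of \<open>T\<close> makes \<open>R n x\<close> a Cauchy sequence as well.
\<close>

lemma decreasing_positive_sot_convergent:
  fixes R :: "nat \<Rightarrow> ('a :: complex_hilbert_space \<Rightarrow>\<^sub>L 'a)"
  assumes pos: "\<And>n. R n \<in> positive_ops"
    and dec: "\<And>m n. m \<le> n \<Longrightarrow> R m - R n \<in> positive_ops"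
  shows "limitin strong_operator_topology R (sot_lim R) sequentially"
proof -
  have bound: "norm (R m - R n) \<le> norm (R 0)" if "m \<le> n" for m n
  proof (rule order_trans[OF positive_norm_mono])
    show "R m - R n \<in> positive_ops" by (rule dec[OF that])
    \<comment> \<open>Monotonicity of the norm is applied to \<open>R m - R n\<close> below \<open>R m\<close>, whose gap is \<open>R n\<close>.\<close>
    show "R m - (R m - R n) \<in> positive_ops" by (simp add: pos)
    show "norm (R m) \<le> norm (R 0)" by (rule positive_norm_mono[OF pos dec]) simp
  qed
  have "convergent (\<lambda>n. R n x)" for x
  proof -
    define q where "q n = Re (cinner x (R n x))" for n
    have "decseq q"
    proof (rule decseq_SucI)
      fix n
      show "q (Suc n) \<le> q n"
        using positiveD[OF dec[of n "Suc n"], of x]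
        by (simp add: q_def blinfun.diff_left cinner.diff_right)
    qed
    moreover have "0 \<le> q n" for n
      unfolding q_def by (rule positiveD[OF pos])
    ultimately have "convergent q"
      using decseq_convergent[of q 0] unfolding convergent_def by metis
    hence c: "Cauchy q" by (rule convergent_Cauchy)
    have "Cauchy (\<lambda>n. R n x)"
    proof (rule CauchyI')
      fix e :: real assume e: "0 < e"
      \<comment> \<open>The \<open>1\<close> keeps the divisor positive when \<open>R 0 = 0\<close>.\<close>
      define d where "d = e\<^sup>2 / (norm (R 0) + 1)"
      have r: "norm (R 0) + 1 > 0" by (simp add: add_nonneg_pos)
      have "d > 0" using e r by (simp add: d_def)
      from metric_CauchyD[OF c this] obtain M
        where M: "\<And>m n. m \<ge> M \<Longrightarrow> n \<ge> M \<Longrightarrow> dist (q m) (q n) < d" by blast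
      have "norm (R m x - R n x) < e" if mn: "m \<ge> M" "m < n" for m n
      proof -
        have le: "m \<le> n" using mn by simp
        have "(norm ((R m - R n) x))\<^sup>2 \<le> norm (R m - R n) * Re (cinner x ((R m - R n) x))"
          by (rule positive_norm_apply[OF dec[OF le]])
        also have "\<dots> \<le> (norm (R 0) + 1) * Re (cinner x ((R m - R n) x))"
          using bound[OF le] by (intro mult_right_mono positiveD[OF dec[OF le]]) simp
        also have "Re (cinner x ((R m - R n) x)) = q m - q n"
          by (simp add: q_def blinfun.diff_left cinner.diff_right)
        also have "(norm (R 0) + 1) * (q m - q n) < (norm (R 0) + 1) * d"
          using M[of m n] mn r by (intro mult_strict_left_mono) (auto simp: dist_real_def)
        also have "\<dots> = e\<^sup>2" using r by (simp add: d_def)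
        finally have "norm ((R m - R n) x) < e"
          by (rule power2_less_imp_less) (use e in simp)
        thus ?thesis by (simp add: blinfun.diff_left)
      qed
      thus "\<exists>M. \<forall>m\<ge>M. \<forall>n>m. dist (R m x) (R n x) < e"
        unfolding dist_norm by blast
    qed
    thus ?thesis by (rule Cauchy_convergent)
  qed
  then obtain f where f: "\<And>x. (\<lambda>n. R n x) \<longlonglongrightarrow> f x"
    unfolding convergent_def by metis
  have "bounded_linear f"
  proof (rule bounded_linear_intro)
    fix x y and r :: real
    have "(\<lambda>n. R n (x + y)) \<longlonglongrightarrow> f x + f y"
      unfolding blinfun.add_right by (intro tendsto_add f)
    thus "f (x + y) = f x + f y" by (rule LIMSEQ_unique[OF f])
    have "(\<lambda>n. R n (r *\<^sub>R x)) \<longlonglongrightarrow> r *\<^sub>R f x"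
      unfolding blinfun.scaleR_right by (intro tendsto_scaleR tendsto_const f)
    thus "f (r *\<^sub>R x) = r *\<^sub>R f x" by (rule LIMSEQ_unique[OF f])
    have "norm (R n x) \<le> norm x * norm (R 0)" for n
      using order_trans[OF norm_blinfun mult_right_mono[OF positive_norm_mono[OF pos dec[of 0 n]]], of x]
      by (simp add: mult.commute)
    thus "norm (f x) \<le> norm x * norm (R 0)"
      by (intro LIMSEQ_le_const2[OF tendsto_norm[OF f]]) blast
  qed
  hence "limitin strong_operator_topology R (Blinfun f) sequentially"
    by (simp add: limitin_strong_operator_iff bounded_linear_Blinfun_apply f)
  thus ?thesis using sot_lim_eqI by metis
qed

section \<open>Peeling off rank-one operators\<close>

lemma ketbra_apply: "ketbra a b x = cinner b x *\<^sub>C a"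
  by (simp add: ketbra.rep_eq)

lemma cinner_ketbra_self: "cinner x (ketbra a a x) = complex_of_real ((cmod (cinner a x))\<^sup>2)"
  unfolding ketbra_apply cinner_scaleC_right complex_norm_square
  by (simp only: cinner_commute[of x a])

lemma ketbra_positive: "ketbra a a \<in> positive_ops"
proof -
  have "ketbra a a \<in> bounded_ops"
    by (simp add: bounded_ops_def ketbra_apply cinner_scaleC_right scaleC_scaleC)
  thus ?thesis
    by (simp add: positive_ops_def cinner_ketbra_self del: of_real_power)
qed

lemma hermitian_sandwich_ketbra:
  assumes "hermitian S"
  shows "S o\<^sub>L ketbra v v o\<^sub>L S = ketbra (S v) (S v)"
proof (rule blinfun_eqI)
  fix x
  have "S (c *\<^sub>C y) = c *\<^sub>C S y" for c y
    using hermitian_complex_linear[OF assms] by (simp add: bounded_ops_def)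
  thus "(S o\<^sub>L ketbra v v o\<^sub>L S) x = ketbra (S v) (S v) x"
    by (simp only: blinfun_apply_blinfun_compose ketbra_apply hermitianD[OF assms])
qed

text \<open>One step of the recursion removes a single rank-one operator, because \<open>A\<close> itself is \<open>S I S\<close> for its root \<open>S\<close>.\<close>

lemma sqrt_sandwich_diff:
  fixes A :: "'a :: complex_hilbert_space \<Rightarrow>\<^sub>L 'a"
  assumes A: "A \<in> positive_ops"
  shows "A - (sqrt_op A o\<^sub>L (id_blinfun - ketbra v v) o\<^sub>L sqrt_op A) = ketbra (sqrt_op A v) (sqrt_op A v)"
proof -
  have "A - (sqrt_op A o\<^sub>L (id_blinfun - ketbra v v) o\<^sub>L sqrt_op A)
      = sqrt_op A o\<^sub>L ketbra v v o\<^sub>L sqrt_op A"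
    by (subst (1) sqrt_op_square[OF A, symmetric], rule blinfun_eqI) (simp add: blinfun.bilinear_simps)
  thus ?thesis
    by (simp add: hermitian_sandwich_ketbra positive_hermitian sqrt_op_positive[OF A])
qed

text \<open>
  At \<open>x\<close> the form is that of \<open>I - |v\<rangle>\<langle>v|\<close> at \<open>S x\<close>, which is nonnegative by Cauchy-Schwarz as \<open>v\<close> is
  a unit vector.
\<close>

lemma sqrt_sandwich_positive:
  fixes A :: "'a :: complex_hilbert_space \<Rightarrow>\<^sub>L 'a"
  assumes A: "A \<in> positive_ops" and v: "norm v = 1"
  shows "sqrt_op A o\<^sub>L (id_blinfun - ketbra v v) o\<^sub>L sqrt_op A \<in> positive_ops"
proof -
  define S where "S = sqrt_op A"
  have h: "hermitian S"
    unfolding S_def by (rule positive_hermitian[OF sqrt_op_positive[OF A]])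
  have hP: "hermitian (id_blinfun - ketbra v v)"
    by (intro hermitian_diff hermitian_id positive_hermitian[OF ketbra_positive])
  have "0 \<le> Re (cinner x ((S o\<^sub>L (id_blinfun - ketbra v v) o\<^sub>L S) x))" for x
  proof -
    have "cmod (cinner v (S x)) \<le> norm (S x)"
      using cinner_Cauchy_Schwarz[of v "S x"] v by simp
    hence "(cmod (cinner v (S x)))\<^sup>2 \<le> (norm (S x))\<^sup>2"
      by (rule power_mono) simp
    moreover have "cinner x ((S o\<^sub>L (id_blinfun - ketbra v v) o\<^sub>L S) x)
        = cinner (S x) ((id_blinfun - ketbra v v) (S x))"
      by (simp only: blinfun_apply_blinfun_compose hermitianD[OF h])
    ultimately show ?thesis
      by (simp add: blinfun.diff_left cinner.diff_right cinner_ketbra_self Re_cinner_self)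
  qed
  moreover have "hermitian (S o\<^sub>L (id_blinfun - ketbra v v) o\<^sub>L S)"
    using h hP by (simp add: hermitian_def)
  ultimately show ?thesis
    by (simp add: positive_ops_iff S_def)
qed

text \<open>
  Decrease of \<open>R\<close> is read off the telescoped differences, which are sums of rank-one projections up
  to scaling; the two infinite statements are then limits of the finite one.
\<close>

theorem proposition3p2:
  fixes R :: "nat \<Rightarrow> ('a :: complex_hilbert_space \<Rightarrow>\<^sub>L 'a)"
    and u E :: "nat \<Rightarrow> 'a"
    and Rinf :: "'a \<Rightarrow>\<^sub>L 'a"
  assumes R0: "R 0 \<in> positive_ops"
    and u: "\<And>n. norm (u n) = 1"
    and R_Suc: "\<And>n. R (Suc n) =
      sqrt_op (R n) o\<^sub>L (id_blinfun - ketbra (u n) (u n)) o\<^sub>L sqrt_op (R n)"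
    and E: "\<And>n. E n = sqrt_op (R n) (u n)"
    and Rinf: "Rinf = sot_lim R"
  shows "(\<forall>N\<ge>1. R 0 - R N = (\<Sum>n=0..N-1. ketbra (E n) (E n))) \<and>
    (\<forall>x. summable (\<lambda>n. norm ((cmod (cinner (E n) x))\<^sup>2)) \<and>
         cinner x ((R 0 - Rinf) x) = complex_of_real (\<Sum>n. (cmod (cinner (E n) x))\<^sup>2)) \<and>
    limitin strong_operator_topology (\<lambda>N. \<Sum>n<N. ketbra (E n) (E n)) (R 0 - Rinf) sequentially"
proof -
  have pos: "R n \<in> positive_ops" for n
    by (induction n) (simp_all only: R0 R_Suc sqrt_sandwich_positive u)
  have step: "R n - R (Suc n) = ketbra (E n) (E n)" for n
    unfolding R_Suc E by (rule sqrt_sandwich_diff[OF pos])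
  have tele: "R m - R n = (\<Sum>k=m..<n. ketbra (E k) (E k))" if "m \<le> n" for m n
    \<comment> \<open>Applied to \<open>- R\<close>, because \<open>sum_Suc_diff'\<close> sums \<open>f (Suc k) - f k\<close>.\<close>
    using sum_Suc_diff'[OF that, of "\<lambda>k. - R k"] by (simp flip: step)
  have quad: "cinner x ((\<Sum>k\<in>K. ketbra (E k) (E k)) x) = complex_of_real (\<Sum>k\<in>K. (cmod (cinner (E k) x))\<^sup>2)"
    for x K
    by (simp add: blinfun.sum_left cinner.sum_right cinner_ketbra_self)
  have dec: "R m - R n \<in> positive_ops" if "m \<le> n" for m n
  proof -
    have "hermitian (R m - R n)" by (intro hermitian_diff positive_hermitian pos)
    thus ?thesis
      unfolding positive_ops_iff tele[OF that] quad by (simp add: sum_nonneg)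
  qed
  have lim: "(\<lambda>N. R N x) \<longlonglongrightarrow> Rinf x" for x
    using decreasing_positive_sot_convergent[of R, OF pos dec]
    unfolding Rinf limitin_strong_operator_iff by blast
  have part: "(\<Sum>n<N. ketbra (E n) (E n)) = R 0 - R N" for N
    by (simp add: tele lessThan_atLeast0)
  have lim_part: "(\<lambda>N. (\<Sum>n<N. ketbra (E n) (E n)) x) \<longlonglongrightarrow> (R 0 - Rinf) x" for x
    unfolding part blinfun.diff_left by (intro tendsto_diff tendsto_const lim)
  have sums: "(\<lambda>n. complex_of_real ((cmod (cinner (E n) x))\<^sup>2)) sums cinner x ((R 0 - Rinf) x)" for x
    unfolding sums_def of_real_sum[symmetric] quad[symmetric]
    by (intro cinner.tendsto tendsto_const lim_part)
  show ?thesis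
  proof (intro conjI allI impI)
    fix N :: nat assume "1 \<le> N"
    thus "R 0 - R N = (\<Sum>n=0..N-1. ketbra (E n) (E n))"
      by (cases N) (simp_all add: tele atLeastLessThanSuc_atLeastAtMost)
  next
    fix x
    show "summable (\<lambda>n. norm ((cmod (cinner (E n) x))\<^sup>2))"
      using sums_summable[OF sums[of x]] unfolding summable_of_real_iff by simp
    thus "cinner x ((R 0 - Rinf) x) = complex_of_real (\<Sum>n. (cmod (cinner (E n) x))\<^sup>2)"
      using sums_unique[OF sums[of x]] by (simp add: suminf_of_real del: of_real_power)
  next
    show "limitin strong_operator_topology (\<lambda>N. \<Sum>n<N. ketbra (E n) (E n)) (R 0 - Rinf) sequentially"
      unfolding limitin_strong_operator_iff using lim_part by blast
  qed
qed

end
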